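(* Consider the Parent-Child MPC architecture at a time step $k$. Suppose the Parent problem at time $k$ is feasible, and let $(z^{P}_{i|k}),(v^{P}_{i|k})$ be its solution, with the associated Parent trajectory $(x^{P}_{i|k})$, $(u^{P}_{i|k})$ generated under the ancillary control law $u^{P}_{i|k}=v^{P}_{i|k}+K^{P}(x^{P}_{i|k}-z^{P}_{i|k})$. Then the warm start $$z^{C}_{i|k}=x^{P}_{i|k}\ (i=k,\dots,k+N^{C}),\qquad \Delta v^{C}_{i|k}=0\ (i=k,\dots,k+N^{C}-1)$$ (equivalently $v^{C}_{i|k}=u^{P}_{i|k}$) satisfies all constraints of the Child problem at time $k$. In particular, the nominal Child problem is feasible whenever the Parent problem is feasible.
   Context: **System.** $x_{k+1}=Ax_k+g(x_k)+Bu_k+w_k$ with $x_k\in\mathcal{X}\subseteq\mathbb{R}^n$, $u_k\in\mathcal{U}\subseteq\mathbb{R}^m$, $w_k\in\mathcal{W}\subseteq\mathbb{R}^n$. The sets $\mathcal{X},\mathcal{U},\mathcal{W}$ are convex and compact, $w_k$ is an unknown disturbance, $(A,B)$ is stabilizable, $g(0)=0$, and $\|g(x)-g(y)\|\le L\|x-y\|$ for all $x,y\in\mathcal{X}$, with $L>0$. **Notation.** $\oplus,\ominus$ are Minkowski sum and difference: $S\oplus T=\{s+t: s\in S,t\in T\}$, $S\ominus T=\{s: s+t\in S\ \forall t\in T\}$. $a_{j|k}$ is the value of $a$ at time $j$ predicted at time $k$, with $a_{k|k}=a_k$. **Data.** $Q,R$ are symmetric positive definite. $K^{P}$ and $K^{f}$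 are gains such that $A+BK^{P}$ and $A+BK^{f}$ are Schur stable. $P$ is the positive definite solution of $(A+BK^{f})^\top P(A+BK^{f})+Q+(K^{f})^\top RK^{f}=P$. The horizons are integers $1\le N^{C}\le N^{P}$. **Child tube.** $\mathcal{E}^{C}\subseteq\mathbb{R}^n$ is the cross section of the Child tube. The actual system is controlled by an ancillary feedback law $u_k=\pi(x_k,z^{C}_k,v^{C}_k)\in\mathcal{U}$ such that $x_k\in\{z^{C}_k\}\oplus\mathcal{E}^{C}$ implies $x_{k+1}\in\{z^{C}_{k+1|k}\}\oplus\mathcal{E}^{C}$ for all $w_k\in\mathcal{W}$ (robust positive invariance of the Child tube). $\mathcal{V}^{C}$ is the corresponding tightened input set for the nominal Child inputs. **Parent tube.** $\mathcal{E}^{P}\subseteq\mathbb{R}^n$ is robust positive invariant for the Parent error dynamics: $(A+BK^{P})e+w\in\mathcal{E}^{P}$ for all $e\in\mathcal{E}^{P}$, $w\in\mathcal{W}^{P}$, where $\mathcal{W}^{P}$ is a bounded set containing $\{g(x):x\in\mathcal{X}\}$. Moreover $\mathcal{E}^{P}\subseteq\mathcal{Z}^{C}_{N^{C}}$, where $\mathcal{Z}^{C}_{N^{C}}$ is the set of nominal states that the model $z_{i+1}=Az_i+g(z_i)+Bv_i$ can steer in $N^{C}$ steps, by an admissible nominal Child input sequence, into a given terminal region $\mathcal{Z}^{f,C}$. **Parent problem at time $k$** (parameter $z^{C}_{k|k-1}$): minimize over $z^{P}_{k|k},\dots,z^{P}_{k+N^{P}|k}$ and $v^{P}_{k|k},\dots,v^{P}_{k+N^{P}-1|k}$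 the cost $$\sum_{i=k}^{k+N^{P}-1}\big((z^{P}_{i|k})^\top Qz^{P}_{i|k}+(v^{P}_{i|k})^\top Rv^{P}_{i|k}\big)+(z^{P}_{k+N^{P}|k})^\top Pz^{P}_{k+N^{P}|k}$$ subject to, for $i=k,\dots,k+N^{P}-1$: $z^{C}_{k|k-1}\in\{z^{P}_{k|k}\}\oplus\mathcal{E}^{P}$; $z^{P}_{i+1|k}=Az^{P}_{i|k}+Bv^{P}_{i|k}$; $z^{P}_{i+1|k}\in(\mathcal{X}\ominus\mathcal{E}^{C})\ominus\mathcal{E}^{P}$; $v^{P}_{i|k}\in\mathcal{V}^{C}\ominus K^{P}\mathcal{E}^{P}$; $z^{P}_{k+N^{P}|k}\in\mathcal{Z}^{f,P}$, where $\mathcal{Z}^{f,P}$ is the Parent terminal set. **Parent (virtual) trajectory.** Given the Parent solution, $x^{P}_{k|k}=z^{C}_{k|k-1}$, $u^{P}_{i|k}=v^{P}_{i|k}+K^{P}(x^{P}_{i|k}-z^{P}_{i|k})$, $x^{P}_{i+1|k}=Ax^{P}_{i|k}+g(x^{P}_{i|k})+Bu^{P}_{i|k}$. **Child problem at time $k$** (parameters: measured state $x_k$ and the Parent solution): minimize over $z^{C}_{k|k},\dots,z^{C}_{k+N^{C}|k}$ and $\Delta v^{C}_{k|k},\dots,\Delta v^{C}_{k+N^{C}-1|k}$ the cost $$\sum_{i=k}^{k+N^{C}-1}\big((z^{C}_{i|k})^\top Qz^{C}_{i|k}+(v^{C}_{i|k})^\top Rv^{C}_{i|k}\big)+(z^{C}_{k+N^{C}|k})^\top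 Pz^{C}_{k+N^{C}|k}$$ subject to, for $i=k,\dots,k+N^{C}-1$: $x_k\in\{z^{C}_{k|k}\}\oplus\mathcal{E}^{C}$; $z^{C}_{i+1|k}=Az^{C}_{i|k}+g(z^{C}_{i|k})+Bv^{C}_{i|k}$; $z^{C}_{j|k}\in\{z^{P}_{j|k}\}\oplus\mathcal{E}^{P}$ for $j=k,\dots,k+N^{C}$; $v^{C}_{i|k}=v^{P}_{i|k}+K^{P}(x^{P}_{i|k}-z^{P}_{i|k})+\Delta v^{C}_{i|k}$; $\Delta v^{C}_{i|k}\in(\mathcal{V}^{C}\ominus K^{P}\mathcal{E}^{P})\ominus\{v^{P}_{i|k}\}$. **Convention.** $z^{C}_{k|k-1}$ is the one-step-ahead nominal state in the solution of the Child problem at time $k-1$. Thus the Parent and Child problems at time $k-1$ were solved (in particular, $x_{k-1}\in\{z^{C}_{k-1|k-1}\}\oplus\mathcal{E}^{C}$ and $z^{C}_{k|k-1}\in\{z^{P}_{k|k-1}\}\oplus\mathcal{E}^{P}$), and the actual system evolved from $x_{k-1}$ to $x_k$ under the ancillary law $\pi$ with some $w_{k-1}\in\mathcal{W}$.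
   Formalization: The Child tube cross section is additionally assumed to contain the origin (its nominal centre); without this the tightened state set need not lie inside the state set and the warm start can violate the Child constraints. *)

theory Defs
  imports "HOL-Analysis.Analysis"
begin

text \<open>The Minkowski sum is \<open>S + T\<close> from \<open>HOL-Library.Set_Algebras\<close>; \<open>S - T\<close> on sets is the
  set-theoretic difference, so the Minkowski difference needs its own symbol.\<close>

definition mink_diff :: "'a::plus set \<Rightarrow> 'a set \<Rightarrow> 'a set" (infixl "\<ominus>" 65)
  where "S \<ominus> T = {s. \<forall>t\<in>T. s + t \<in> S}"

definition schur_stable :: "real^'n^'n \<Rightarrow> bool"
  where "schur_stable M \<longleftrightarrow>
    (\<forall>c v. v \<noteq> 0 \<and> (\<chi> i j. complex_of_real (M $ i $ j)) *v v = c *s v \<longrightarrow> norm c < 1)"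

definition stabilizable :: "real^'n^'n \<Rightarrow> real^'m^'n \<Rightarrow> bool"
  where "stabilizable A B \<longleftrightarrow> (\<exists>K. schur_stable (A + B ** K))"

definition sym_pos_def :: "real^'n^'n \<Rightarrow> bool"
  where "sym_pos_def M \<longleftrightarrow> transpose M = M \<and> (\<forall>v. v \<noteq> 0 \<longrightarrow> 0 < v \<bullet> (M *v v))"

text \<open>\<open>ancillary x z v\<close> is the feedback law \<open>\<pi>\<close> of the Child tube, \<open>term_C\<close> and \<open>term_P\<close> are the
  terminal regions of the Child and of the Parent.\<close>

record ('n::finite, 'm::finite) mpc =
  sys_A :: "real^'n^'n"
  sys_B :: "real^'m^'n"
  sys_g :: "real^'n \<Rightarrow> real^'n"
  lip_L :: real
  set_X :: "(real^'n) set"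
  set_U :: "(real^'m) set"
  set_W :: "(real^'n) set"
  cost_Q :: "real^'n^'n"
  cost_R :: "real^'m^'m"
  cost_P :: "real^'n^'n"
  gain_P :: "real^'n^'m"
  gain_f :: "real^'n^'m"
  hor_P :: nat
  hor_C :: nat
  tube_C :: "(real^'n) set"
  ancillary :: "real^'n \<Rightarrow> real^'n \<Rightarrow> real^'m \<Rightarrow> real^'m"
  inputs_C :: "(real^'m) set"
  term_C :: "(real^'n) set"
  tube_P :: "(real^'n) set"
  dist_P :: "(real^'n) set"
  term_P :: "(real^'n) set"

definition nominal_step :: "('n::finite, 'm::finite) mpc \<Rightarrow> real^'n \<Rightarrow> real^'m \<Rightarrow> real^'n"
  where "nominal_step M x u = sys_A M *v x + sys_g M x + sys_B M *v u"

definition steerable_C :: "('n::finite, 'm::finite) mpc \<Rightarrow> (real^'n) set"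
  where "steerable_C M = {z0. \<exists>z v. z 0 = z0
    \<and> (\<forall>i<hor_C M. v i \<in> inputs_C M \<and> z (Suc i) = nominal_step M (z i) (v i))
    \<and> z (hor_C M) \<in> term_C M}"

definition system_assms :: "('n::finite, 'm::finite) mpc \<Rightarrow> bool"
  where "system_assms M \<longleftrightarrow>
    convex (set_X M) \<and> compact (set_X M) \<and>
    convex (set_U M) \<and> compact (set_U M) \<and>
    convex (set_W M) \<and> compact (set_W M) \<and>
    stabilizable (sys_A M) (sys_B M) \<and>
    sys_g M 0 = 0 \<and> 0 < lip_L M \<and> (lip_L M)-lipschitz_on (set_X M) (sys_g M)"

definition cost_assms :: "('n::finite, 'm::finite) mpc \<Rightarrow> bool"
  where "cost_assms M \<longleftrightarrow>
    sym_pos_def (cost_Q M) \<and> sym_pos_def (cost_R M) \<and> sym_pos_def (cost_P M) \<and>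
    schur_stable (sys_A M + sys_B M ** gain_P M) \<and>
    schur_stable (sys_A M + sys_B M ** gain_f M) \<and>
    transpose (sys_A M + sys_B M ** gain_f M) ** cost_P M ** (sys_A M + sys_B M ** gain_f M)
      + cost_Q M + transpose (gain_f M) ** cost_R M ** gain_f M = cost_P M \<and>
    1 \<le> hor_C M \<and> hor_C M \<le> hor_P M"

text \<open>The first conjunct, that the tube contains its nominal centre, is what makes the tightened set
  \<open>set_X M \<ominus> tube_C M\<close> a subset of \<open>set_X M\<close>.\<close>

definition child_tube_assms :: "('n::finite, 'm::finite) mpc \<Rightarrow> bool"
  where "child_tube_assms M \<longleftrightarrow>
    0 \<in> tube_C M \<and>
    (\<forall>x\<in>set_X M. \<forall>z. \<forall>v\<in>inputs_C M. x \<in> {z} + tube_C M \<longrightarrow>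
      ancillary M x z v \<in> set_U M \<and>
      (\<forall>w\<in>set_W M. nominal_step M x (ancillary M x z v) + w \<in> {nominal_step M z v} + tube_C M))"

definition parent_tube_assms :: "('n::finite, 'm::finite) mpc \<Rightarrow> bool"
  where "parent_tube_assms M \<longleftrightarrow>
    bounded (dist_P M) \<and> sys_g M ` set_X M \<subseteq> dist_P M \<and>
    (\<forall>e\<in>tube_P M. \<forall>w\<in>dist_P M. (sys_A M + sys_B M ** gain_P M) *v e + w \<in> tube_P M) \<and>
    tube_P M \<subseteq> steerable_C M"

definition standing_assms :: "('n::finite, 'm::finite) mpc \<Rightarrow> bool"
  where "standing_assms M \<longleftrightarrow>
    system_assms M \<and> cost_assms M \<and> child_tube_assms M \<and> parent_tube_assms M"

text \<open>The two optimal control problems are time invariant. A sequence predicted at time \<open>k\<close> is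
  indexed by the offset \<open>j\<close> from \<open>k\<close>, i.e. \<open>z j\<close> stands for the prediction \<open>z\<close> of time \<open>k + j\<close>
  made at time \<open>k\<close>. Only the offsets up to the horizon are constrained. The parameter \<open>\<zeta>\<close> of the
  Parent problem is the nominal Child state predicted one step earlier.\<close>

definition horizon_cost ::
    "('n::finite, 'm::finite) mpc \<Rightarrow> nat \<Rightarrow> (nat \<Rightarrow> real^'n) \<Rightarrow> (nat \<Rightarrow> real^'m) \<Rightarrow> real"
  where "horizon_cost M N z v =
    (\<Sum>j<N. z j \<bullet> (cost_Q M *v z j) + v j \<bullet> (cost_R M *v v j)) + z N \<bullet> (cost_P M *v z N)"

definition parent_admissible ::
    "('n::finite, 'm::finite) mpc \<Rightarrow> real^'n \<Rightarrow> (nat \<Rightarrow> real^'n) \<Rightarrow> (nat \<Rightarrow> real^'m) \<Rightarrow> bool"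
  where "parent_admissible M \<zeta> z v \<longleftrightarrow>
    \<zeta> \<in> {z 0} + tube_P M \<and>
    (\<forall>j<hor_P M.
      z (Suc j) = sys_A M *v z j + sys_B M *v v j \<and>
      z (Suc j) \<in> (set_X M \<ominus> tube_C M) \<ominus> tube_P M \<and>
      v j \<in> inputs_C M \<ominus> (\<lambda>e. gain_P M *v e) ` tube_P M) \<and>
    z (hor_P M) \<in> term_P M"

definition parent_feasible :: "('n::finite, 'm::finite) mpc \<Rightarrow> real^'n \<Rightarrow> bool"
  where "parent_feasible M \<zeta> \<longleftrightarrow> (\<exists>z v. parent_admissible M \<zeta> z v)"

definition parent_solution ::
    "('n::finite, 'm::finite) mpc \<Rightarrow> real^'n \<Rightarrow> (nat \<Rightarrow> real^'n) \<Rightarrow> (nat \<Rightarrow> real^'m) \<Rightarrow> bool"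
  where "parent_solution M \<zeta> z v \<longleftrightarrow>
    parent_admissible M \<zeta> z v \<and>
    (\<forall>z' v'. parent_admissible M \<zeta> z' v' \<longrightarrow>
      horizon_cost M (hor_P M) z v \<le> horizon_cost M (hor_P M) z' v')"

definition parent_law :: "('n::finite, 'm::finite) mpc \<Rightarrow> real^'m \<Rightarrow> real^'n \<Rightarrow> real^'n \<Rightarrow> real^'m"
  where "parent_law M v x z = v + gain_P M *v (x - z)"

primrec parent_state ::
    "('n::finite, 'm::finite) mpc \<Rightarrow> real^'n \<Rightarrow> (nat \<Rightarrow> real^'n) \<Rightarrow> (nat \<Rightarrow> real^'m) \<Rightarrow> nat \<Rightarrow> real^'n"
  where
    "parent_state M \<zeta> z v 0 = \<zeta>"
  | "parent_state M \<zeta> z v (Suc j) =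
      nominal_step M (parent_state M \<zeta> z v j) (parent_law M (v j) (parent_state M \<zeta> z v j) (z j))"

definition parent_input ::
    "('n::finite, 'm::finite) mpc \<Rightarrow> real^'n \<Rightarrow> (nat \<Rightarrow> real^'n) \<Rightarrow> (nat \<Rightarrow> real^'m) \<Rightarrow> nat \<Rightarrow> real^'m"
  where "parent_input M \<zeta> z v j = parent_law M (v j) (parent_state M \<zeta> z v j) (z j)"

text \<open>In the Child problem \<open>x\<close> is the measured state, \<open>(\<zeta>, zP, vP)\<close> are the parameter and the
  solution of the Parent problem, and \<open>(z, dv)\<close> are the decision variables.\<close>

definition child_input ::
    "('n::finite, 'm::finite) mpc \<Rightarrow> real^'n \<Rightarrow> (nat \<Rightarrow> real^'n) \<Rightarrow> (nat \<Rightarrow> real^'m) \<Rightarrow>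
      (nat \<Rightarrow> real^'m) \<Rightarrow> nat \<Rightarrow> real^'m"
  where "child_input M \<zeta> zP vP dv j =
    vP j + gain_P M *v (parent_state M \<zeta> zP vP j - zP j) + dv j"

definition child_admissible ::
    "('n::finite, 'm::finite) mpc \<Rightarrow> real^'n \<Rightarrow> real^'n \<Rightarrow> (nat \<Rightarrow> real^'n) \<Rightarrow> (nat \<Rightarrow> real^'m) \<Rightarrow>
      (nat \<Rightarrow> real^'n) \<Rightarrow> (nat \<Rightarrow> real^'m) \<Rightarrow> bool"
  where "child_admissible M x \<zeta> zP vP z dv \<longleftrightarrow>
    x \<in> {z 0} + tube_C M \<and>
    (\<forall>j<hor_C M. z (Suc j) = nominal_step M (z j) (child_input M \<zeta> zP vP dv j)) \<and>
    (\<forall>j\<le>hor_C M. z j \<in> {zP j} + tube_P M) \<and>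
    (\<forall>j<hor_C M. dv j \<in> (inputs_C M \<ominus> (\<lambda>e. gain_P M *v e) ` tube_P M) \<ominus> {vP j})"

definition child_feasible ::
    "('n::finite, 'm::finite) mpc \<Rightarrow> real^'n \<Rightarrow> real^'n \<Rightarrow> (nat \<Rightarrow> real^'n) \<Rightarrow> (nat \<Rightarrow> real^'m) \<Rightarrow> bool"
  where "child_feasible M x \<zeta> zP vP \<longleftrightarrow> (\<exists>z dv. child_admissible M x \<zeta> zP vP z dv)"

definition child_solution ::
    "('n::finite, 'm::finite) mpc \<Rightarrow> real^'n \<Rightarrow> real^'n \<Rightarrow> (nat \<Rightarrow> real^'n) \<Rightarrow> (nat \<Rightarrow> real^'m) \<Rightarrow>
      (nat \<Rightarrow> real^'n) \<Rightarrow> (nat \<Rightarrow> real^'m) \<Rightarrow> bool"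
  where "child_solution M x \<zeta> zP vP z dv \<longleftrightarrow>
    child_admissible M x \<zeta> zP vP z dv \<and>
    (\<forall>z' dv'. child_admissible M x \<zeta> zP vP z' dv' \<longrightarrow>
      horizon_cost M (hor_C M) z (child_input M \<zeta> zP vP dv)
        \<le> horizon_cost M (hor_C M) z' (child_input M \<zeta> zP vP dv'))"

end

theory Submission
  imports Defs
begin

text \<open>The warm start copies the Parent trajectory, so its dynamics hold by construction, and with the
  corrections zero the Child input constraint is that of the Parent. Two things remain: the measured state has to lie in the Child tube around the new nominal state, and
  the Parent trajectory has to stay in the Parent tube.

  The first is the robust invariance of the Child tube, applied to the step that has just been taken
  (\<open>child_step_in_tube\<close>). It requires the nominal Child input of that step to lie in the tightened
  input set: it is the sum of a nominal part in \<open>inputs_C M \<ominus> K tube_P M\<close> and a feedback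
  \<open>K e\<close> with \<open>e \<in> tube_P M\<close>.

  The second is an induction over the horizon (\<open>parent_state_in_tube\<close>). The deviation
  \<open>e = x - z\<close> of the Parent state from the linear Parent prediction obeys
  \<open>e' = (A + B K) e + g x\<close>, so the nonlinearity acts as a disturbance and the Parent tube is
  invariant under it as long as \<open>g x\<close> lies in \<open>dist_P M\<close>, which is the case when \<open>x \<in> set_X M\<close>. The
  tightened state constraints of the Parent turn membership in the tube back into membership in
  \<open>set_X M\<close>, which closes the induction. The Parent state constraints begin with the first successor,
  so at the initial state this argument is run one step earlier: that state was predicted by the previous
  Child problem and lies in the tube around a constrained state of the previous Parent problem
  (\<open>child_prediction_in_state_set\<close>).\<close>

lemma in_singleton_plus_iff: "x \<in> {z} + T \<longleftrightarrow> x - z \<in> T"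
  for x z :: "'a::ab_group_add"
  by (auto simp: set_plus_def intro!: bexI[of _ "x - z"])

lemma in_mink_diffD: "s \<in> S \<ominus> T \<Longrightarrow> t \<in> T \<Longrightarrow> s + t \<in> S"
  by (simp add: mink_diff_def)

text \<open>The two tightenings of the Parent state constraint are undone here: that by the Parent tube
  absorbs the deviation of \<open>x\<close> from \<open>z\<close>, and that by the Child tube is undone at the centre of
  the tube, the deviation zero.\<close>

lemma tightened_state_in_state_set:
  assumes "0 \<in> tube_C M"
    and "z \<in> (set_X M \<ominus> tube_C M) \<ominus> tube_P M"
    and "x \<in> {z} + tube_P M"
  shows "x \<in> set_X M"
proof -
  have "z + (x - z) \<in> set_X M \<ominus> tube_C M"
    using assms(2,3) by (intro in_mink_diffD) (simp_all add: in_singleton_plus_iff)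
  then show ?thesis
    using in_mink_diffD[OF _ assms(1)] by fastforce
qed

lemma parent_error_step:
  "nominal_step M x (parent_law M v x z) - (sys_A M *v z + sys_B M *v v)
    = (sys_A M + sys_B M ** gain_P M) *v (x - z) + sys_g M x"
  by (simp add: nominal_step_def parent_law_def matrix_vector_mult_add_rdistrib
      matrix_vector_mult_diff_distrib matrix_vector_right_distrib
      matrix_vector_mul_assoc[symmetric] algebra_simps)

lemma parent_tube_step:
  assumes "parent_tube_assms M" and "x \<in> set_X M" and "x \<in> {z} + tube_P M"
  shows "nominal_step M x (parent_law M v x z)
    \<in> {sys_A M *v z + sys_B M *v v} + tube_P M"
  using assms by (auto simp: in_singleton_plus_iff parent_error_step parent_tube_assms_def)

text \<open>The assumption on \<open>\<zeta>\<close> supplies the base case: Parent admissibility bounds the predicted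
  states only from the first successor on.\<close>

lemma parent_state_in_tube:
  assumes "0 \<in> tube_C M" and "parent_tube_assms M"
    and adm: "parent_admissible M \<zeta> z v"
    and "\<zeta> \<in> set_X M"
    and "j \<le> hor_P M"
  shows "parent_state M \<zeta> z v j \<in> {z j} + tube_P M"
proof -
  have "parent_state M \<zeta> z v j \<in> {z j} + tube_P M \<and> parent_state M \<zeta> z v j \<in> set_X M"
    using assms(5)
  proof (induction j)
    case 0
    then show ?case
      using adm assms(4) by (simp add: parent_admissible_def)
  next
    case (Suc j)
    have z: "z (Suc j) = sys_A M *v z j + sys_B M *v v j"
        "z (Suc j) \<in> (set_X M \<ominus> tube_C M) \<ominus> tube_P M"
      using adm Suc.prems unfolding parent_admissible_def Suc_le_eq by blast+
    have "parent_state M \<zeta> z v (Suc j) \<in> {z (Suc j)} + tube_P M"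
      using parent_tube_step[OF assms(2)] Suc by (simp add: z(1))
    then show ?case
      using tightened_state_in_state_set[OF assms(1) z(2)] by blast
  qed
  then show ?thesis ..
qed

lemma child_prediction_in_state_set:
  assumes "0 \<in> tube_C M"
    and "parent_admissible M \<zeta> zP vP"
    and "child_admissible M x \<zeta> zP vP z dv"
    and "Suc j \<le> hor_C M" and "hor_C M \<le> hor_P M"
  shows "z (Suc j) \<in> set_X M"
proof (rule tightened_state_in_state_set[OF assms(1)])
  show "zP (Suc j) \<in> (set_X M \<ominus> tube_C M) \<ominus> tube_P M"
    using assms(2) less_le_trans[OF Suc_le_lessD[OF assms(4)] assms(5)]
    unfolding parent_admissible_def by blast
  show "z (Suc j) \<in> {zP (Suc j)} + tube_P M"
    using assms(3,4) unfolding child_admissible_def by blast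
qed

text \<open>The feedback part \<open>K e\<close> of the Child input is covered by the margin \<open>K tube_P M\<close> that the
  Child constraint keeps free. The argument is confined to the first input, where the Parent state
  is \<open>\<zeta>\<close> and its membership in the tube is a constraint of the Parent problem.\<close>

lemma first_child_input_admissible:
  assumes "parent_admissible M \<zeta> zP vP"
    and "child_admissible M x \<zeta> zP vP z dv"
    and "0 < hor_C M"
  shows "child_input M \<zeta> zP vP dv 0 \<in> inputs_C M"
proof -
  have "dv 0 + vP 0 \<in> inputs_C M \<ominus> (\<lambda>e. gain_P M *v e) ` tube_P M"
    using assms(2,3) by (intro in_mink_diffD[where T = "{vP 0}"]) (simp_all add: child_admissible_def)
  moreover have "\<zeta> - zP 0 \<in> tube_P M"
    using assms(1) by (simp add: parent_admissible_def in_singleton_plus_iff)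
  ultimately have "dv 0 + vP 0 + gain_P M *v (\<zeta> - zP 0) \<in> inputs_C M"
    by (blast intro: in_mink_diffD)
  then show ?thesis
    by (simp add: child_input_def algebra_simps)
qed

lemma child_step_in_tube:
  assumes "child_tube_assms M"
    and "parent_admissible M \<zeta> zP vP"
    and child: "child_admissible M x \<zeta> zP vP z dv"
    and "0 < hor_C M"
    and "x \<in> set_X M" and "w \<in> set_W M"
  shows "nominal_step M x (ancillary M x (z 0) (child_input M \<zeta> zP vP dv 0)) + w
    \<in> {z 1} + tube_C M"
proof -
  have "z 1 = nominal_step M (z 0) (child_input M \<zeta> zP vP dv 0)" "x \<in> {z 0} + tube_C M"
    using child assms(4) by (simp_all add: child_admissible_def)
  then show ?thesis
    using assms(1,5,6) first_child_input_admissible[OF assms(2) child assms(4)]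
    by (simp add: child_tube_assms_def)
qed

lemma child_input_zero_correction:
  "child_input M \<zeta> z v (\<lambda>j. 0) = parent_input M \<zeta> z v"
  by (simp add: fun_eq_iff child_input_def parent_input_def parent_law_def)

lemma warm_start_admissible:
  assumes "0 \<in> tube_C M" and "parent_tube_assms M" and "hor_C M \<le> hor_P M"
    and "x \<in> {\<zeta>} + tube_C M" and "\<zeta> \<in> set_X M"
    and adm: "parent_admissible M \<zeta> z v"
  shows "child_admissible M x \<zeta> z v (parent_state M \<zeta> z v) (\<lambda>j. 0)"
proof -
  have "(0::real^_) \<in> (inputs_C M \<ominus> (\<lambda>e. gain_P M *v e) ` tube_P M) \<ominus> {v j}"
    if "j < hor_C M" for j
    \<comment> \<open>Tightening by a singleton is a translation, so this is the Parent input constraint.\<close>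
    using adm that assms(3) by (simp add: mink_diff_def[of _ "{v j}"] parent_admissible_def)
  moreover have "parent_state M \<zeta> z v j \<in> {z j} + tube_P M" if "j \<le> hor_C M" for j
    using parent_state_in_tube[OF assms(1,2) adm assms(5)] that assms(3) by simp
  ultimately show ?thesis
    using assms(4)
    by (simp add: child_admissible_def child_input_zero_correction parent_input_def)
qed

theorem theorem2:
  fixes M :: "('n::finite, 'm::finite) mpc"
    and k :: nat
    and x w \<zeta> :: "nat \<Rightarrow> real^'n"
    and zP zC :: "nat \<Rightarrow> nat \<Rightarrow> real^'n"
    and vP dv :: "nat \<Rightarrow> nat \<Rightarrow> real^'m"
  assumes "standing_assms M"
    and "1 \<le> k"
    and "parent_solution M (\<zeta> (k - 1)) (zP (k - 1)) (vP (k - 1))"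
    and "child_solution M (x (k - 1)) (\<zeta> (k - 1)) (zP (k - 1)) (vP (k - 1)) (zC (k - 1)) (dv (k - 1))"
    and "x (k - 1) \<in> set_X M"
    and "w (k - 1) \<in> set_W M"
    and "x k = nominal_step M (x (k - 1))
           (ancillary M (x (k - 1)) (zC (k - 1) 0)
             (child_input M (\<zeta> (k - 1)) (zP (k - 1)) (vP (k - 1)) (dv (k - 1)) 0)) + w (k - 1)"
    and "\<zeta> k = zC (k - 1) 1"
    and "parent_feasible M (\<zeta> k)"
  shows "(\<forall>z v. parent_solution M (\<zeta> k) z v \<longrightarrow>
            child_admissible M (x k) (\<zeta> k) z v (parent_state M (\<zeta> k) z v) (\<lambda>j. 0) \<and>
            (\<forall>j<hor_C M. child_input M (\<zeta> k) z v (\<lambda>j. 0) j = parent_input M (\<zeta> k) z v j)) \<and>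
         (\<forall>z v. parent_admissible M (\<zeta> k) z v \<longrightarrow> child_feasible M (x k) (\<zeta> k) z v)"
proof -
  have tubes: "child_tube_assms M" "0 \<in> tube_C M" "parent_tube_assms M"
    and horizons: "0 < hor_C M" "Suc 0 \<le> hor_C M" "hor_C M \<le> hor_P M"
    using assms(1) by (auto simp: standing_assms_def child_tube_assms_def cost_assms_def)
  have parent: "parent_admissible M (\<zeta> (k - 1)) (zP (k - 1)) (vP (k - 1))"
    and child: "child_admissible M (x (k - 1)) (\<zeta> (k - 1)) (zP (k - 1)) (vP (k - 1))
      (zC (k - 1)) (dv (k - 1))"
    using assms(3,4) by (simp_all add: parent_solution_def child_solution_def)
  have "\<zeta> k \<in> set_X M"
    using child_prediction_in_state_set[OF tubes(2) parent child horizons(2,3)]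
    by (simp add: assms(8))
  moreover have "x k \<in> {\<zeta> k} + tube_C M"
    using child_step_in_tube[OF tubes(1) parent child horizons(1) assms(5,6)]
    by (simp only: assms(7,8))
  ultimately have warm_start:
      "child_admissible M (x k) (\<zeta> k) z v (parent_state M (\<zeta> k) z v) (\<lambda>j. 0)"
    if "parent_admissible M (\<zeta> k) z v" for z v
    using warm_start_admissible[OF tubes(2,3) horizons(3)] that by blast
  then show ?thesis
    by (auto simp: parent_solution_def child_feasible_def child_input_zero_correction)
qed

end
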